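(* Let $X\subseteq\mathbb{R}^n$ be a nonempty closed convex set, let $\|\cdot\|$ be an arbitrary (but fixed) norm on $\mathbb{R}^n$, and let $f:X\to\mathbb{R}$ be a differentiable convex function that is Lipschitz-continuous with parameter $L>0$ with respect to $\|\cdot\|$, i.e. $|f(\mathbf{x})-f(\hat{\mathbf{x}})|\le L\|\mathbf{x}-\hat{\mathbf{x}}\|$ for all $\mathbf{x},\hat{\mathbf{x}}\in X$. Let $\mathbf{x}^*\in X$ be a minimizer of $f$ over $X$. Let $\psi:X\to\mathbb{R}$ be continuously differentiable and $\sigma$-strongly convex with respect to $\|\cdot\|$ ($\sigma>0$). Let $\mathbf{x}^{(k)},\mathbf{z}^{(k)},\hat{\mathbf{x}}^{(k)},\hat{\mathbf{z}}^{(k)}$ be updated according to the AXGD algorithm with weights $a_k$ and $A_k=\sum_{i=1}^k a_i$, starting from an arbitrary initial point $\hat{\mathbf{x}}^{(0)}\in X$ with $\mathbf{z}^{(0)}=\nabla\psi(\hat{\mathbf{x}}^{(0)})$ and $A_0=0$. If $$a_k=\frac{\sqrt{\sigma}}{2\sqrt2\,L}\sqrt{\frac{D_\psi(\mathbf{x}^*,\hat{\mathbf{x}}^{(0)})}{k}}\quad(k\ge1),$$ then for all $k\ge1$, $$f(\mathbf{x}^{(k)})-f(\mathbf{x}^* )\le 8\,(2+\log(k))\,\frac{L\cdot\sqrt{D_\psi(\mathbf{x}^*,\hat{\mathbf{x}}^{(0)})}}{\sqrt{\sigma}\sqrt{k}}.$$ In particular, for $\psi(\mathbf{x})=\frac{\sigma}{2}\|\mathbf{x}\|^2$,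 for all $k\ge1$, $$f(\mathbf{x}^{(k)})-f(\mathbf{x}^* )\le 4\sqrt2\,(2+\log(k))\,\frac{L\cdot\|\mathbf{x}^*-\hat{\mathbf{x}}^{(0)}\|}{\sqrt{k}}.$$
   Context: $\langle\cdot,\cdot\rangle$ is the standard pairing on $\mathbb{R}^n$; $\log$ is the natural logarithm; $\nabla$ denotes the gradient. $f$ is convex on $X$ if $f(\hat{\mathbf{x}})\ge f(\mathbf{x})+\langle\nabla f(\mathbf{x}),\hat{\mathbf{x}}-\mathbf{x}\rangle$ for all $\mathbf{x},\hat{\mathbf{x}}\in X$. $\psi$ is $\sigma$-strongly convex if $\psi(\hat{\mathbf{x}})\ge\psi(\mathbf{x})+\langle\nabla\psi(\mathbf{x}),\hat{\mathbf{x}}-\mathbf{x}\rangle+\frac{\sigma}{2}\|\hat{\mathbf{x}}-\mathbf{x}\|^2$ for all $\mathbf{x},\hat{\mathbf{x}}\in X$. The Bregman divergence is $D_\psi(\mathbf{x},\hat{\mathbf{x}})=\psi(\mathbf{x})-\psi(\hat{\mathbf{x}})-\langle\nabla\psi(\hat{\mathbf{x}}),\mathbf{x}-\hat{\mathbf{x}}\rangle$. The convex conjugate is $\psi^*(\mathbf{z})=\max_{\mathbf{x}\in X}\{\langle\mathbf{z},\mathbf{x}\rangle-\psi(\mathbf{x})\}$ for $\mathbf{z}\in\mathbb{R}^n$; it satisfies $\nabla\psi^*(\mathbf{z})=\arg\max_{\mathbf{x}\in X}\{\langle\mathbf{z},\mathbf{x}\rangle-\psi(\mathbf{x})\}\in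 X$. AXGD (Accelerated Extra-Gradient Descent), for weights $a_k$ that are understood to be positive: for $k=0,1,2,\dots$, $$\hat{\mathbf{x}}^{(k)}=\tfrac{A_k}{A_{k+1}}\mathbf{x}^{(k)}+\tfrac{a_{k+1}}{A_{k+1}}\nabla\psi^*(\mathbf{z}^{(k)}),\qquad \hat{\mathbf{z}}^{(k)}=\mathbf{z}^{(k)}-a_{k+1}\nabla f(\hat{\mathbf{x}}^{(k)}),$$ $$\mathbf{x}^{(k+1)}=\tfrac{A_k}{A_{k+1}}\mathbf{x}^{(k)}+\tfrac{a_{k+1}}{A_{k+1}}\nabla\psi^*(\hat{\mathbf{z}}^{(k)}),\qquad \mathbf{z}^{(k+1)}=\mathbf{z}^{(k)}-a_{k+1}\nabla f(\mathbf{x}^{(k+1)}).$$ For $k=0$ the terms with $\mathbf{x}^{(0)}$ have coefficient $A_0/A_1=0$ and are absent, and the first formula is consistent with the given $\hat{\mathbf{x}}^{(0)}$ since $\nabla\psi^*(\nabla\psi(\hat{\mathbf{x}}^{(0)}))=\hat{\mathbf{x}}^{(0)}$.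
   Formalization: The final "in particular" bound for ψ = (σ/2)‖x‖² is proved only for norms induced by an inner product; for an arbitrary norm on a general X it is false, since the Bregman divergence can far exceed (σ/2)‖x* − x̂⁽⁰⁾‖². *)

theory Defs
  imports "HOL-Analysis.Analysis"
begin

text \<open>The real normed vector space classes fix one norm per type (the Euclidean one on
  \<^typ>\<open>real ^ 'n\<close>), so an arbitrary norm is a function.\<close>

definition is_norm :: "(real ^ 'n \<Rightarrow> real) \<Rightarrow> bool" where
  "is_norm N \<longleftrightarrow>
     (\<forall>x. 0 \<le> N x) \<and> (\<forall>x. N x = 0 \<longleftrightarrow> x = 0) \<and>
     (\<forall>c x. N (c *\<^sub>R x) = \<bar>c\<bar> * N x) \<and>
     (\<forall>x y. N (x + y) \<le> N x + N y)"

text \<open>For \<open>\<psi> = \<sigma>/2 N\<^sup>2\<close> the Bregman divergence equals \<open>\<sigma>/2 N (x - y)\<^sup>2\<close> when \<open>N\<close> comes from an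
  inner product, not necessarily the standard one. For other norms it can be much larger, even
  where \<open>\<psi>\<close> is \<open>\<sigma>\<close>-strongly convex with respect to \<open>N\<close> on \<open>X\<close>.\<close>

definition inner_product_norm :: "(real ^ 'n \<Rightarrow> real) \<Rightarrow> bool" where
  "inner_product_norm N \<longleftrightarrow>
     (\<exists>B. bilinear B \<and> (\<forall>x y. B x y = B y x) \<and> (\<forall>x. x \<noteq> 0 \<longrightarrow> 0 < B x x) \<and>
          (\<forall>x. N x = sqrt (B x x)))"

text \<open>Functions on \<open>X\<close> are total functions of which only the values on \<open>X\<close> matter, and they
  are differentiated within \<open>X\<close>. If \<open>X\<close> has empty interior, the gradient is determined only up
  to vectors orthogonal to the affine hull of \<open>X\<close>; for this reason it is a parameter
  \<open>g\<close> below, and any choice is allowed.\<close>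

definition gradient_on :: "(real ^ 'n) set \<Rightarrow> (real ^ 'n \<Rightarrow> real) \<Rightarrow> (real ^ 'n \<Rightarrow> real ^ 'n) \<Rightarrow> bool" where
  "gradient_on X f g \<longleftrightarrow> (\<forall>x\<in>X. (f has_derivative (\<lambda>h. g x \<bullet> h)) (at x within X))"

definition convex_diff_on :: "(real ^ 'n) set \<Rightarrow> (real ^ 'n \<Rightarrow> real) \<Rightarrow> (real ^ 'n \<Rightarrow> real ^ 'n) \<Rightarrow> bool" where
  "convex_diff_on X f g \<longleftrightarrow> (\<forall>x\<in>X. \<forall>y\<in>X. f y \<ge> f x + g x \<bullet> (y - x))"

definition strongly_convex_diff_on ::
  "real \<Rightarrow> (real ^ 'n \<Rightarrow> real) \<Rightarrow> (real ^ 'n) set \<Rightarrow> (real ^ 'n \<Rightarrow> real) \<Rightarrow> (real ^ 'n \<Rightarrow> real ^ 'n) \<Rightarrow> bool" where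
  "strongly_convex_diff_on \<sigma> N X \<psi> g \<longleftrightarrow>
     (\<forall>x\<in>X. \<forall>y\<in>X. \<psi> y \<ge> \<psi> x + g x \<bullet> (y - x) + \<sigma> / 2 * (N (y - x))\<^sup>2)"

definition lipschitz_wrt :: "real \<Rightarrow> (real ^ 'n \<Rightarrow> real) \<Rightarrow> (real ^ 'n) set \<Rightarrow> (real ^ 'n \<Rightarrow> real) \<Rightarrow> bool" where
  "lipschitz_wrt L N X f \<longleftrightarrow> (\<forall>x\<in>X. \<forall>y\<in>X. \<bar>f x - f y\<bar> \<le> L * N (x - y))"

definition bregman :: "(real ^ 'n \<Rightarrow> real) \<Rightarrow> (real ^ 'n \<Rightarrow> real ^ 'n) \<Rightarrow> real ^ 'n \<Rightarrow> real ^ 'n \<Rightarrow> real" where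
  "bregman \<psi> g x y = \<psi> x - \<psi> y - g y \<bullet> (x - y)"

text \<open>For \<open>\<psi>\<close> strongly convex on a nonempty closed convex \<open>X\<close> the supremum is an attained
  maximum.\<close>

definition convex_conjugate :: "(real ^ 'n) set \<Rightarrow> (real ^ 'n \<Rightarrow> real) \<Rightarrow> real ^ 'n \<Rightarrow> real" where
  "convex_conjugate X \<psi> z = (SUP x\<in>X. z \<bullet> x - \<psi> x)"

definition gradient :: "(real ^ 'n \<Rightarrow> real) \<Rightarrow> real ^ 'n \<Rightarrow> real ^ 'n" where
  "gradient F z = (THE D. GDERIV F z :> D)"

definition weight_sum :: "(nat \<Rightarrow> real) \<Rightarrow> nat \<Rightarrow> real" where
  "weight_sum a k = (\<Sum>i=1..k. a i)"

text \<open>\<open>xh\<close>, \<open>zh\<close> are the extrapolated (hatted) sequences. Since \<open>weight_sum a 0 = 0\<close>, the value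
  \<open>x 0\<close> is irrelevant; for \<open>k = 0\<close> the first equation holds for every \<open>xh 0 \<in> X\<close> with
  \<open>z 0\<close> the gradient of \<open>\<psi>\<close> at \<open>xh 0\<close>, so it does not restrict the initial point.\<close>

definition AXGD ::
  "(real ^ 'n) set \<Rightarrow> (real ^ 'n \<Rightarrow> real ^ 'n) \<Rightarrow> (real ^ 'n \<Rightarrow> real) \<Rightarrow> (real ^ 'n \<Rightarrow> real ^ 'n) \<Rightarrow> (nat \<Rightarrow> real) \<Rightarrow>
   (nat \<Rightarrow> real ^ 'n) \<Rightarrow> (nat \<Rightarrow> real ^ 'n) \<Rightarrow> (nat \<Rightarrow> real ^ 'n) \<Rightarrow> (nat \<Rightarrow> real ^ 'n) \<Rightarrow> bool" where
  "AXGD X gf \<psi> g\<psi> a x z xh zh \<longleftrightarrow>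
     (\<forall>k\<ge>1. 0 < a k) \<and>
     xh 0 \<in> X \<and> z 0 = g\<psi> (xh 0) \<and>
     (let A = weight_sum a; P = gradient (convex_conjugate X \<psi>) in
      \<forall>k. xh k = (A k / A (k + 1)) *\<^sub>R x k + (a (k + 1) / A (k + 1)) *\<^sub>R P (z k) \<and>
          zh k = z k - a (k + 1) *\<^sub>R gf (xh k) \<and>
          x (k + 1) = (A k / A (k + 1)) *\<^sub>R x k + (a (k + 1) / A (k + 1)) *\<^sub>R P (zh k) \<and>
          z (k + 1) = z k - a (k + 1) *\<^sub>R gf (x (k + 1)))"

end

theory Submission
  imports Defs
begin

text \<open>Write \<open>P\<close> for the gradient of \<open>\<psi>\<^sup>*\<close>, i.e. the argmax map, and let
  \<open>\<Phi>\<^sub>k = \<psi>\<^sup>*(z\<^sub>k) - \<langle>z\<^sub>k, x\<^sup>*\<rangle> + \<psi>(x\<^sup>*) \<ge> 0\<close>. Convexity of \<open>f\<close> bounds the increment of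
  \<open>A\<^sub>k (f(x\<^sub>k) - f(x\<^sup>*))\<close> by \<open>a \<langle>\<nabla>f(x\<^sub>k\<^sub>+\<^sub>1), P(zh\<^sub>k) - x\<^sup>*\<rangle>\<close>, and \<open>\<Phi>\<close> increases by at most
  \<open>a \<langle>\<nabla>f(x\<^sub>k\<^sub>+\<^sub>1), x\<^sup>* - P(z\<^sub>k\<^sub>+\<^sub>1)\<rangle>\<close>. The dual points \<open>zh\<^sub>k\<close> and \<open>z\<^sub>k\<^sub>+\<^sub>1\<close> differ by \<open>a\<close> times a difference
  of two gradients of \<open>f\<close>, so by strong convexity their images under \<open>P\<close> are \<open>2 a L / \<sigma>\<close>-close
  and the sum of the two potentials grows by at most \<open>2 a\<^sup>2 L\<^sup>2 / \<sigma>\<close>. Summing up and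
  dividing by \<open>A\<^sub>k\<close> gives the bound, with room to spare in the constant.\<close>

section \<open>Norm comparison and one-sided directional derivatives\<close>

text \<open>By homogeneity it suffices to look at the Euclidean unit sphere, where compactness gives
  a positive minimum. This translates strong convexity with respect to \<open>N\<close> into
  Euclidean estimates, in which compactness and differentiability are expressed.\<close>

lemma is_norm_lower_bound:
  fixes N :: "real ^ 'n \<Rightarrow> real"
  assumes "is_norm N"
  obtains c where "c > 0" "\<And>v. c * norm v \<le> N v"
proof -
  have tri: "N (x + y) \<le> N x + N y" and hom: "N (r *\<^sub>R x) = \<bar>r\<bar> * N x"
    and pos: "0 \<le> N x" and zero: "N x = 0 \<longleftrightarrow> x = 0" for x y r
    using assms unfolding is_norm_def by auto
  \<comment> \<open>Convexity serves to obtain continuity: a real convex function on all of a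
    finite-dimensional space is continuous.\<close>
  have "convex_on UNIV N"
  proof (rule convex_onI)
    fix t :: real and x y assume "0 < t" "t < 1"
    then show "N ((1 - t) *\<^sub>R x + t *\<^sub>R y) \<le> (1 - t) * N x + t * N y"
      using tri[of "(1 - t) *\<^sub>R x" "t *\<^sub>R y"] by (simp add: hom)
  qed simp
  then have cont: "continuous_on (sphere 0 1) N"
    using convex_on_continuous[of UNIV N] continuous_on_subset by blast
  have "sphere (0 :: real ^ 'n) 1 \<noteq> {}" by simp
  from continuous_attains_inf[OF compact_sphere this cont]
  obtain s where s: "s \<in> sphere 0 1" and min: "\<And>v. v \<in> sphere 0 1 \<Longrightarrow> N s \<le> N v"
    by blast
  show ?thesis
  proof (rule that)
    have "N s \<noteq> 0" using s zero[of s] by auto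
    then show "N s > 0" using pos[of s] by linarith
    show "N s * norm v \<le> N v" for v
    proof (cases "v = 0")
      case False
      then have "N s \<le> N ((1 / norm v) *\<^sub>R v)" by (intro min) simp
      with False show ?thesis by (simp add: hom field_simps)
    qed (simp add: pos)
  qed
qed

text \<open>Chain rule along the segment from \<open>x\<close> to \<open>u\<close>, which stays in
  \<open>X\<close> by convexity. The limit is one-sided because \<open>x\<close> may lie on the
  boundary. Only feasible directions enter, so the ambiguity of the gradient on a set with empty
  interior does no harm.\<close>

lemma has_derivative_directional:
  fixes f :: "'a::real_inner \<Rightarrow> real"
  assumes der: "(f has_derivative (\<lambda>h. D \<bullet> h)) (at x within X)"
    and "convex X" "x \<in> X" "u \<in> X"
  shows "((\<lambda>t. (f (x + t *\<^sub>R (u - x)) - f x) / t) \<longlongrightarrow> D \<bullet> (u - x)) (at_right 0)"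
proof -
  let ?l = "\<lambda>t::real. x + t *\<^sub>R (u - x)"
  have sub: "?l ` {0..1} \<subseteq> X"
  proof safe
    fix t :: real assume "t \<in> {0..1}"
    then have "(1 - t) *\<^sub>R x + t *\<^sub>R u \<in> X" using assms by (intro convexD) auto
    then show "?l t \<in> X" by (simp add: algebra_simps)
  qed
  have "(?l has_derivative (\<lambda>t. t *\<^sub>R (u - x))) (at 0 within {0..1})"
    by (auto intro!: derivative_eq_intros)
  moreover have "(f has_derivative (\<lambda>h. D \<bullet> h)) (at (?l 0) within ?l ` {0..1})"
    using der sub by (auto intro: has_derivative_subset)
  ultimately have "((\<lambda>t. f (?l t)) has_derivative (\<lambda>t. D \<bullet> (t *\<^sub>R (u - x)))) (at 0 within {0..1})"
    by (rule has_derivative_in_compose)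
  moreover have "(\<lambda>t. D \<bullet> (t *\<^sub>R (u - x))) = (*) (D \<bullet> (u - x))"
    by (rule ext) simp
  ultimately have "((\<lambda>t. f (?l t)) has_field_derivative D \<bullet> (u - x)) (at 0 within {0..1})"
    by (simp only: has_field_derivative_def)
  then show ?thesis
    by (simp add: has_field_derivative_iff at_within_Icc_at_right)
qed

text \<open>Differentiating at \<open>x\<close> along \<open>u - x\<close> and \<open>v - x\<close> simultaneously bounds the gradient along
  \<open>u - v\<close>, which need not be a feasible direction at \<open>x\<close>.\<close>

lemma lipschitz_gradient_bound:
  assumes "convex X" "is_norm N" "gradient_on X f g" "lipschitz_wrt L N X f"
    and "x \<in> X" "u \<in> X" "v \<in> X"
  shows "g x \<bullet> (u - v) \<le> L * N (u - v)"
proof -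
  have der: "(f has_derivative (\<lambda>h. g x \<bullet> h)) (at x within X)"
    using assms unfolding gradient_on_def by auto
  let ?q = "\<lambda>t. (f (x + t *\<^sub>R (u - x)) - f x) / t - (f (x + t *\<^sub>R (v - x)) - f x) / t"
  have "(?q \<longlongrightarrow> g x \<bullet> (u - x) - g x \<bullet> (v - x)) (at_right 0)"
    using assms by (intro tendsto_diff has_derivative_directional[OF der])
  moreover have "eventually (\<lambda>t::real. t \<in> {0<..<1}) (at_right 0)"
    by (intro eventually_at_rightI) auto
  then have "eventually (\<lambda>t. ?q t \<le> L * N (u - v)) (at_right 0)"
  proof eventually_elim
    case (elim t)
    have mem: "x + t *\<^sub>R (w - x) \<in> X" if "w \<in> X" for w
      using convexD[OF \<open>convex X\<close> \<open>x \<in> X\<close> that, of "1 - t" t] elim by (simp add: algebra_simps)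
    have "f (x + t *\<^sub>R (u - x)) - f (x + t *\<^sub>R (v - x))
        \<le> L * N ((x + t *\<^sub>R (u - x)) - (x + t *\<^sub>R (v - x)))"
      using assms(4) mem[OF \<open>u \<in> X\<close>] mem[OF \<open>v \<in> X\<close>] unfolding lipschitz_wrt_def by fastforce
    also have "(x + t *\<^sub>R (u - x)) - (x + t *\<^sub>R (v - x)) = t *\<^sub>R (u - v)"
      by (simp add: algebra_simps)
    also have "N (t *\<^sub>R (u - v)) = t * N (u - v)"
      using \<open>is_norm N\<close> elim unfolding is_norm_def by auto
    finally show ?case using elim by (simp add: field_simps)
  qed
  ultimately have "g x \<bullet> (u - x) - g x \<bullet> (v - x) \<le> L * N (u - v)"
    by (intro tendsto_upperbound) auto
  then show ?thesis by (simp add: inner_diff_right)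
qed

section \<open>The argmax map and the gradient of the conjugate\<close>

text \<open>Quadratic growth of \<psi> beats the linear term outside a ball, so a maximizer over the
  compact part of \<open>X\<close> is global. First-order optimality at \<open>p\<close>, inserted
  into strong convexity at \<open>p\<close>, yields the quadratic gap.\<close>

lemma strongly_convex_argmax:
  fixes X :: "(real ^ 'n) set"
  assumes "X \<noteq> {}" "closed X" "convex X" "is_norm N" "gradient_on X \<psi> g" "\<sigma> > 0"
    and sc: "strongly_convex_diff_on \<sigma> N X \<psi> g"
  obtains p where "p \<in> X" "\<And>y. y \<in> X \<Longrightarrow> z \<bullet> y - \<psi> y + \<sigma> / 2 * (N (y - p))\<^sup>2 \<le> z \<bullet> p - \<psi> p"
proof -
  obtain c where c: "c > 0" "\<And>v. c * norm v \<le> N v"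
    using is_norm_lower_bound[OF \<open>is_norm N\<close>] by blast
  obtain x0 where x0: "x0 \<in> X" using assms by auto
  let ?h = "\<lambda>y. z \<bullet> y - \<psi> y"
  \<comment> \<open>The radius beyond which the guaranteed growth
    \<open>\<sigma> / 2 * (c * r)\<^sup>2\<close> at distance \<open>r\<close> from
    \<open>x0\<close> outweighs the largest linear gain \<open>norm (z - g x0) * r\<close>.\<close>
  define R where "R = 2 * norm (z - g x0) / (\<sigma> * c\<^sup>2)"
  have "R \<ge> 0" using c \<open>\<sigma> > 0\<close> by (simp add: R_def)
  have far: "?h y \<le> ?h x0" if "y \<in> X" "norm (y - x0) \<ge> R" for y
  proof -
    let ?n = "norm (y - x0)"
    have "(c * ?n)\<^sup>2 \<le> (N (y - x0))\<^sup>2" using c by (intro power_mono) auto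
    then have "\<sigma> / 2 * (c\<^sup>2 * ?n\<^sup>2) \<le> \<sigma> / 2 * (N (y - x0))\<^sup>2"
      using \<open>\<sigma> > 0\<close> by (intro mult_left_mono) (auto simp: power_mult_distrib)
    moreover have "\<psi> y \<ge> \<psi> x0 + g x0 \<bullet> (y - x0) + \<sigma> / 2 * (N (y - x0))\<^sup>2"
      using sc x0 that unfolding strongly_convex_diff_on_def by blast
    moreover have "(z - g x0) \<bullet> (y - x0) \<le> norm (z - g x0) * ?n"
      by (rule norm_cauchy_schwarz)
    moreover have "norm (z - g x0) * ?n \<le> (\<sigma> * c\<^sup>2 / 2 * ?n) * ?n"
      using that c \<open>\<sigma> > 0\<close> by (intro mult_right_mono) (auto simp: R_def field_simps)
    ultimately show ?thesis
      by (simp add: inner_diff_left inner_diff_right power2_eq_square algebra_simps)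
  qed
  have "continuous_on X \<psi>"
    using assms(5) unfolding gradient_on_def
    by (auto simp: continuous_on_eq_continuous_within intro: has_derivative_continuous)
  then have cont: "continuous_on (X \<inter> cball x0 R) ?h"
    by (intro continuous_intros) (auto intro: continuous_on_subset)
  have comp: "compact (X \<inter> cball x0 R)"
    using \<open>closed X\<close> by (intro closed_Int_compact) auto
  have x0': "x0 \<in> X \<inter> cball x0 R" using x0 \<open>R \<ge> 0\<close> by simp
  then have "X \<inter> cball x0 R \<noteq> {}" by blast
  from continuous_attains_sup[OF comp this cont]
  obtain p where p: "p \<in> X \<inter> cball x0 R"
    and pmax: "\<And>y. y \<in> X \<inter> cball x0 R \<Longrightarrow> ?h y \<le> ?h p"
    by blast
  have max: "?h y \<le> ?h p" if "y \<in> X" for y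
  proof (cases "y \<in> cball x0 R")
    case False
    then have "?h y \<le> ?h x0" using that by (intro far) (auto simp: dist_norm norm_minus_commute)
    then show ?thesis using pmax[OF x0'] by linarith
  qed (use that pmax in auto)
  show ?thesis
  proof
    show "p \<in> X" using p by simp
    fix y assume "y \<in> X"
    \<comment> \<open>Variational inequality at \<open>p\<close>: maximality bounds each difference
      quotient of \<psi> towards \<open>y\<close> from below by \<open>z \<bullet> (y - p)\<close>,
      and the bound survives the limit.\<close>
    have "((\<lambda>t. (\<psi> (p + t *\<^sub>R (y - p)) - \<psi> p) / t) \<longlongrightarrow> g p \<bullet> (y - p)) (at_right 0)"
      using assms \<open>p \<in> X\<close> \<open>y \<in> X\<close> unfolding gradient_on_def
      by (intro has_derivative_directional[where X = X]) auto
    moreover have "eventually (\<lambda>t::real. t \<in> {0<..<1}) (at_right 0)"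
      by (intro eventually_at_rightI) auto
    then have "eventually (\<lambda>t. z \<bullet> (y - p) \<le> (\<psi> (p + t *\<^sub>R (y - p)) - \<psi> p) / t) (at_right 0)"
    proof eventually_elim
      case (elim t)
      have "p + t *\<^sub>R (y - p) \<in> X"
        using convexD[OF \<open>convex X\<close> \<open>p \<in> X\<close> \<open>y \<in> X\<close>, of "1 - t" t] elim
        by (simp add: algebra_simps)
      from max[OF this] have "t * (z \<bullet> (y - p)) \<le> \<psi> (p + t *\<^sub>R (y - p)) - \<psi> p"
        by (simp only: inner_add_right inner_scaleR_right)
      moreover have "t > 0" using elim by simp
      ultimately show ?case by (metis mult.commute pos_le_divide_eq)
    qed
    ultimately have "z \<bullet> (y - p) \<le> g p \<bullet> (y - p)"
      by (intro tendsto_lowerbound) auto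
    moreover have "\<psi> y \<ge> \<psi> p + g p \<bullet> (y - p) + \<sigma> / 2 * (N (y - p))\<^sup>2"
      using sc \<open>p \<in> X\<close> \<open>y \<in> X\<close> unfolding strongly_convex_diff_on_def by blast
    ultimately show "z \<bullet> y - \<psi> y + \<sigma> / 2 * (N (y - p))\<^sup>2 \<le> z \<bullet> p - \<psi> p"
      by (simp add: inner_diff_right)
  qed
qed

text \<open>Add the optimality gap at \<open>z\<close> tested with \<open>P z'\<close> to the gap at
  \<open>z'\<close> tested with \<open>P z\<close>. The values of \<psi> cancel, and the two halves
  of \<sigma> add up.\<close>

lemma argmax_monotone:
  fixes X :: "(real ^ 'n) set"
  assumes "is_norm N"
    and "\<And>z. P z \<in> X"
    and "\<And>z y. y \<in> X \<Longrightarrow> z \<bullet> y - \<psi> y + \<sigma> / 2 * (N (y - P z))\<^sup>2 \<le> z \<bullet> P z - \<psi> (P z)"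
  shows "\<sigma> * (N (P z - P z'))\<^sup>2 \<le> (z - z') \<bullet> (P z - P z')"
proof -
  have "N (P z' - P z) = N ((-1) *\<^sub>R (P z - P z'))" by simp
  also have "\<dots> = N (P z - P z')"
    using \<open>is_norm N\<close> unfolding is_norm_def by (metis abs_minus_cancel abs_one mult_1)
  finally show ?thesis
    using assms(3)[OF assms(2)[of z], of z'] assms(3)[OF assms(2)[of z'], of z]
    by (simp add: inner_diff_left inner_diff_right)
qed

text \<open>Danskin's argument: the conjugate is a maximum of affine functions of \<open>z\<close>,
  so its gradient is the maximizer, provided the maximizer varies continuously. Monotonicity makes
  it even Lipschitz. Uniqueness of the derivative then identifies the definite description
  \<open>gradient\<close> with the argmax map.\<close>

lemma gradient_convex_conjugate:
  fixes X :: "(real ^ 'n) set"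
  assumes "X \<noteq> {}" "closed X" "convex X" "is_norm N" "gradient_on X \<psi> g" "\<sigma> > 0"
    and sc: "strongly_convex_diff_on \<sigma> N X \<psi> g"
  shows gradient_convex_conjugate_in: "gradient (convex_conjugate X \<psi>) z \<in> X"
    and gradient_convex_conjugate_max:
      "y \<in> X \<Longrightarrow> z \<bullet> y - \<psi> y + \<sigma> / 2 * (N (y - gradient (convex_conjugate X \<psi>) z))\<^sup>2
        \<le> z \<bullet> gradient (convex_conjugate X \<psi>) z - \<psi> (gradient (convex_conjugate X \<psi>) z)"
proof -
  let ?F = "convex_conjugate X \<psi>"
  have "\<exists>p. p \<in> X \<and> (\<forall>y\<in>X. z \<bullet> y - \<psi> y + \<sigma> / 2 * (N (y - p))\<^sup>2 \<le> z \<bullet> p - \<psi> p)" for z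
    using strongly_convex_argmax[OF assms] by metis
  then obtain P where P: "P z \<in> X"
      "y \<in> X \<Longrightarrow> z \<bullet> y - \<psi> y + \<sigma> / 2 * (N (y - P z))\<^sup>2 \<le> z \<bullet> P z - \<psi> (P z)" for z y
    by metis
  have max: "w \<bullet> y - \<psi> y \<le> w \<bullet> P w - \<psi> (P w)" if "y \<in> X" for w y
    using P(2)[OF that, of w] \<open>\<sigma> > 0\<close> by (smt (verit) mult_nonneg_nonneg zero_le_power2 divide_nonneg_nonneg)
  have F: "?F w = w \<bullet> P w - \<psi> (P w)" for w
    unfolding convex_conjugate_def using max P(1) by (intro cSup_eq_maximum) auto
  obtain c where c: "c > 0" "\<And>v. c * norm v \<le> N v"
    using is_norm_lower_bound[OF \<open>is_norm N\<close>] by blast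
  have lip: "norm (P w - P w') \<le> norm (w - w') / (\<sigma> * c\<^sup>2)" for w w'
  proof (cases "P w = P w'")
    case False
    let ?n = "norm (P w - P w')"
    have "\<sigma> * (c * ?n)\<^sup>2 \<le> \<sigma> * (N (P w - P w'))\<^sup>2"
      using c \<open>\<sigma> > 0\<close> by (intro mult_left_mono power_mono) auto
    also have "\<dots> \<le> (w - w') \<bullet> (P w - P w')"
      using \<open>is_norm N\<close> P by (rule argmax_monotone)
    also have "\<dots> \<le> norm (w - w') * ?n" by (rule norm_cauchy_schwarz)
    finally have "\<sigma> * c\<^sup>2 * ?n * ?n \<le> norm (w - w') * ?n"
      by (simp add: power2_eq_square mult_ac)
    then have "\<sigma> * c\<^sup>2 * ?n \<le> norm (w - w')" using False by simp
    then show ?thesis using c \<open>\<sigma> > 0\<close> by (simp add: field_simps)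
  qed (use c \<open>\<sigma> > 0\<close> in simp)
  have deriv: "GDERIV ?F w :> P w" for w
    unfolding gderiv_def has_derivative_at
  proof
    show "bounded_linear (\<lambda>h. h \<bullet> P w)" by (rule bounded_linear_inner_left)
  next
    show "(\<lambda>h. norm (?F (w + h) - ?F w - h \<bullet> P w) / norm h) \<midarrow>0\<rightarrow> 0"
    proof (rule Lim_null_comparison)
      show "eventually (\<lambda>h. norm (norm (?F (w + h) - ?F w - h \<bullet> P w) / norm h)
          \<le> norm h / (\<sigma> * c\<^sup>2)) (at 0)"
      proof (rule always_eventually, rule allI)
        fix h
        let ?d = "P (w + h) - P w"
        \<comment> \<open>Testing the maximum at \<open>w + h\<close> with \<open>P w\<close>, and
          the one at \<open>w\<close> with \<open>P (w + h)\<close>, sandwiches the remainder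
          between 0 and \<open>h \<bullet> ?d\<close>, which is quadratic in \<open>h\<close> by
          \<open>lip\<close>.\<close>
        have "0 \<le> ?F (w + h) - ?F w - h \<bullet> P w"
          using max[OF P(1)[of w], of "w + h"] by (simp add: F inner_add_left)
        moreover have "?F (w + h) - ?F w - h \<bullet> P w \<le> h \<bullet> ?d"
          using max[OF P(1)[of "w + h"], of w] by (simp add: F inner_add_left inner_diff_right)
        moreover have "h \<bullet> ?d \<le> norm h * (norm h / (\<sigma> * c\<^sup>2))"
          using norm_cauchy_schwarz[of h ?d] mult_left_mono[OF lip[of "w + h" w], of "norm h"] by simp
        ultimately show "norm (norm (?F (w + h) - ?F w - h \<bullet> P w) / norm h) \<le> norm h / (\<sigma> * c\<^sup>2)"
          by (cases "h = 0") (simp_all add: pos_divide_le_eq mult.commute)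
      qed
      show "((\<lambda>h. norm h / (\<sigma> * c\<^sup>2)) \<longlongrightarrow> 0) (at 0)"
        using c \<open>\<sigma> > 0\<close> by (auto intro!: tendsto_eq_intros)
    qed
  qed
  have "D = P w" if "GDERIV ?F w :> D" for w D
    using that deriv[of w] unfolding gderiv_def
    by (metis (no_types) has_derivative_unique inner_commute vector_eq_rdot)
  then have "gradient ?F w = P w" for w
    unfolding gradient_def using deriv by (intro the_equality)
  then show "gradient ?F z \<in> X"
    "y \<in> X \<Longrightarrow> z \<bullet> y - \<psi> y + \<sigma> / 2 * (N (y - gradient ?F z))\<^sup>2
        \<le> z \<bullet> gradient ?F z - \<psi> (gradient ?F z)"
    using P by simp_all
qed

section \<open>Sums arising from the weights\<close>

lemma sum_inverse_le_ln: "k \<ge> 1 \<Longrightarrow> (\<Sum>i=1..k. 1 / real i) \<le> 1 + ln (real k)"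
proof (induction k rule: dec_induct)
  case (step k)
  \<comment> \<open>The inequality \<open>ln t \<le> t - 1\<close> at \<open>t = k / (k + 1)\<close>
    bounds each new term by an increment of the logarithm.\<close>
  have "ln (real k / real (Suc k)) \<le> real k / real (Suc k) - 1"
    using step by (intro ln_le_minus_one) auto
  also have "\<dots> = - (1 / real (Suc k))" by (simp add: field_simps)
  finally have "1 / real (Suc k) \<le> ln (real (Suc k)) - ln (real k)"
    using step by (simp add: ln_div)
  then show ?case using step by simp
qed simp

lemma sqrt_le_sum_inverse_sqrt: "sqrt (real k) \<le> (\<Sum>i=1..k. 1 / sqrt (real i))"
proof -
  have "sqrt (real k) = (\<Sum>i=1..k. 1 / sqrt (real k))" by (simp add: real_div_sqrt)
  also have "\<dots> \<le> (\<Sum>i=1..k. 1 / sqrt (real i))"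
    by (intro sum_mono divide_left_mono) auto
  finally show ?thesis .
qed

section \<open>The Bregman divergence of a squared inner product norm\<close>

text \<open>The vector \<open>g y\<close> itself need not be determined, but its product with the
  feasible direction \<open>x - y\<close> is: the difference quotient of \<psi> tends both to that
  product and, by direct expansion, to \<open>\<sigma> * B y (x - y)\<close>. The rest is the
  expansion of \<open>B x x\<close> around \<open>y\<close>.\<close>

lemma bregman_inner_product_norm:
  assumes "inner_product_norm N" "convex X" "gradient_on X \<psi> g"
    and \<psi>: "\<forall>y\<in>X. \<psi> y = \<sigma> / 2 * (N y)\<^sup>2" and "x \<in> X" "y \<in> X"
  shows "bregman \<psi> g x y = \<sigma> / 2 * (N (x - y))\<^sup>2"
proof -
  obtain B where B: "bilinear B" "\<And>x y. B x y = B y x" "\<And>x. x \<noteq> 0 \<Longrightarrow> 0 < B x x"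
      "\<And>x. N x = sqrt (B x x)"
    using assms unfolding inner_product_norm_def by metis
  have "B v v \<ge> 0" for v
    using B(3)[of v] bilinear_lzero[OF B(1)] by (cases "v = 0") auto
  then have N2: "(N v)\<^sup>2 = B v v" for v by (simp add: B(4))
  let ?d = "x - y"
  have exp: "B (y + t *\<^sub>R d) (y + t *\<^sub>R d) = B y y + t * (2 * B y d) + t\<^sup>2 * B d d" for t d
    using B(2)[of d y]
    by (simp add: bilinear_ladd[OF B(1)] bilinear_radd[OF B(1)] bilinear_lmul[OF B(1)]
        bilinear_rmul[OF B(1)] power2_eq_square algebra_simps)
  have "((\<lambda>t. (\<psi> (y + t *\<^sub>R ?d) - \<psi> y) / t) \<longlongrightarrow> g y \<bullet> ?d) (at_right 0)"
    using assms unfolding gradient_on_def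
    by (intro has_derivative_directional[where X = X]) auto
  moreover have "((\<lambda>t. (\<psi> (y + t *\<^sub>R ?d) - \<psi> y) / t) \<longlongrightarrow> \<sigma> * B y ?d) (at_right 0)"
  proof (rule Lim_transform_eventually)
    have "((\<lambda>t. \<sigma> * B y ?d + t * (\<sigma> / 2 * B ?d ?d)) \<longlongrightarrow> \<sigma> * B y ?d + 0 * (\<sigma> / 2 * B ?d ?d)) (at_right 0)"
      by (intro tendsto_intros)
    then show "((\<lambda>t. \<sigma> * B y ?d + t * (\<sigma> / 2 * B ?d ?d)) \<longlongrightarrow> \<sigma> * B y ?d) (at_right 0)" by simp
    have "eventually (\<lambda>t::real. t \<in> {0<..<1}) (at_right 0)"
      by (intro eventually_at_rightI) auto
    then show "eventually (\<lambda>t. \<sigma> * B y ?d + t * (\<sigma> / 2 * B ?d ?d)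
        = (\<psi> (y + t *\<^sub>R ?d) - \<psi> y) / t) (at_right 0)"
    proof eventually_elim
      case (elim t)
      have "y + t *\<^sub>R ?d \<in> X"
        using convexD[OF \<open>convex X\<close> \<open>y \<in> X\<close> \<open>x \<in> X\<close>, of "1 - t" t] elim
        by (simp add: algebra_simps)
      then have "\<psi> (y + t *\<^sub>R ?d) = \<sigma> / 2 * (B y y + t * (2 * B y ?d) + t\<^sup>2 * B ?d ?d)"
        using \<psi> by (simp only: N2 exp)
      moreover have "\<psi> y = \<sigma> / 2 * B y y" using \<psi> \<open>y \<in> X\<close> by (simp only: N2)
      ultimately show ?case using elim by (simp add: field_simps power2_eq_square)
    qed
  qed
  ultimately have "g y \<bullet> ?d = \<sigma> * B y ?d"
    by (intro tendsto_unique[of "at_right (0::real)"]) auto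
  moreover have "B x x = B y y + 2 * B y ?d + B ?d ?d" using exp[of 1 ?d] by simp
  ultimately show ?thesis
    using \<psi> \<open>x \<in> X\<close> \<open>y \<in> X\<close> by (simp add: bregman_def N2 algebra_simps)
qed

section \<open>The potential argument and the convergence rate\<close>

theorem theorem2p8:
  fixes X :: "(real ^ 'n) set" and N :: "real ^ 'n \<Rightarrow> real"
    and f \<psi> :: "real ^ 'n \<Rightarrow> real" and gf g\<psi> :: "real ^ 'n \<Rightarrow> real ^ 'n"
    and L \<sigma> :: real and a :: "nat \<Rightarrow> real"
    and xstar :: "real ^ 'n" and x z xh zh :: "nat \<Rightarrow> real ^ 'n"
  assumes "X \<noteq> {}" and "closed X" and "convex X"
    and "is_norm N"
    and "gradient_on X f gf" and "convex_diff_on X f gf"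
    and "L > 0" and "lipschitz_wrt L N X f"
    and "xstar \<in> X" and "\<forall>y\<in>X. f xstar \<le> f y"
    and "gradient_on X \<psi> g\<psi>" and "continuous_on X g\<psi>"
    and "\<sigma> > 0" and "strongly_convex_diff_on \<sigma> N X \<psi> g\<psi>"
    and "AXGD X gf \<psi> g\<psi> a x z xh zh"
    and "\<forall>k\<ge>1. a k = sqrt \<sigma> / (2 * sqrt 2 * L) * sqrt (bregman \<psi> g\<psi> xstar (xh 0) / real k)"
  shows "(\<forall>k\<ge>1. f (x k) - f xstar
            \<le> 8 * (2 + ln (real k)) * (L * sqrt (bregman \<psi> g\<psi> xstar (xh 0))) / (sqrt \<sigma> * sqrt (real k)))
       \<and> (inner_product_norm N \<and> (\<forall>y\<in>X. \<psi> y = \<sigma> / 2 * (N y)\<^sup>2) \<longrightarrow>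
          (\<forall>k\<ge>1. f (x k) - f xstar
            \<le> 4 * sqrt 2 * (2 + ln (real k)) * (L * N (xstar - xh 0)) / sqrt (real k)))"
proof -
  let ?P = "gradient (convex_conjugate X \<psi>)"
  let ?A = "weight_sum a"
  define D where "D = bregman \<psi> g\<psi> xstar (xh 0)"
  define c where "c = sqrt \<sigma> * sqrt D / (2 * sqrt 2 * L)"
  have apos: "0 < a k" if "k \<ge> 1" for k
    using that assms(15) unfolding AXGD_def by blast
  have xh0: "xh 0 \<in> X" and z0: "z 0 = g\<psi> (xh 0)"
    using assms(15) unfolding AXGD_def by auto
  have xh: "xh k = (?A k / ?A (k + 1)) *\<^sub>R x k + (a (k + 1) / ?A (k + 1)) *\<^sub>R ?P (z k)"
    and zh: "zh k = z k - a (k + 1) *\<^sub>R gf (xh k)"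
    and x: "x (k + 1) = (?A k / ?A (k + 1)) *\<^sub>R x k + (a (k + 1) / ?A (k + 1)) *\<^sub>R ?P (zh k)"
    and z: "z (k + 1) = z k - a (k + 1) *\<^sub>R gf (x (k + 1))" for k
    using assms(15) unfolding AXGD_def Let_def by blast+
  note P_in = gradient_convex_conjugate_in[OF assms(1-4) assms(11) assms(13,14)]
  note P_max = gradient_convex_conjugate_max[OF assms(1-4) assms(11) assms(13,14)]
  have A0: "?A 0 = 0" and ASuc: "?A (k + 1) = ?A k + a (k + 1)" for k
    by (simp_all add: weight_sum_def)
  have Anonneg: "?A k \<ge> 0" for k
    unfolding weight_sum_def using apos by (intro sum_nonneg) (auto intro: less_imp_le)
  have Apos: "?A (k + 1) > 0" for k
    using Anonneg[of k] apos[of "k + 1"] ASuc by simp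
  \<comment> \<open>Membership of \<open>u\<close> is demanded only for \<open>k \<ge> 1\<close>: at
    \<open>k = 0\<close> its coefficient vanishes, and \<open>x 0\<close> may lie outside
    \<open>X\<close>.\<close>
  have comb: "(?A k / ?A (k + 1)) *\<^sub>R u + (a (k + 1) / ?A (k + 1)) *\<^sub>R v \<in> X"
    if "k \<ge> 1 \<Longrightarrow> u \<in> X" "v \<in> X" for k u v
  proof (cases "k = 0")
    case True
    then show ?thesis using that ASuc[of 0] A0 Apos[of 0] by simp
  next
    case False
    then show ?thesis
      using that Anonneg[of k] Apos[of k] apos[of "k + 1"] \<open>convex X\<close>
      by (intro convexD) (auto simp: ASuc[of k, simplified] simp flip: add_divide_distrib)
  qed
  have x_in: "x (k + 1) \<in> X" for k
  proof (induction k)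
    case 0
    then show ?case using x[of 0] comb[of 0 "x 0" "?P (zh 0)"] P_in by simp
  next
    case (Suc k)
    then show ?case using x[of "Suc k"] comb[of "Suc k" "x (Suc k)" "?P (zh (Suc k))"] P_in by simp
  qed
  have xh_in: "xh k \<in> X" for k
  proof (cases k)
    case (Suc m)
    then show ?thesis using xh[of k] comb[of k "x k" "?P (z k)"] P_in x_in[of m] by simp
  qed (use xh0 in simp)
  \<comment> \<open>The Fenchel-Young gap of \<open>z k\<close> and \<open>xstar\<close>, with the
    conjugate written out through its maximizer.\<close>
  define \<Phi> where "\<Phi> k = z k \<bullet> ?P (z k) - \<psi> (?P (z k)) - (z k \<bullet> xstar - \<psi> xstar)" for k
  have \<Phi>_nonneg: "\<Phi> k \<ge> 0" for k
  proof -
    have "\<sigma> / 2 * (N (xstar - ?P (z k)))\<^sup>2 \<ge> 0" using \<open>\<sigma> > 0\<close> by simp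
    then show ?thesis
      using P_max[OF \<open>xstar \<in> X\<close>, of "z k"] unfolding \<Phi>_def by linarith
  qed
  have \<Phi>0: "\<Phi> 0 \<le> D"
  proof -
    \<comment> \<open>As \<open>z 0\<close> is the gradient of \<psi> at \<open>xh 0\<close>, this
      shows that the maximum defining the conjugate at \<open>z 0\<close> is at most its value at
      \<open>xh 0\<close>; substituting that value turns the gap into \<open>D\<close>.\<close>
    have "\<psi> (?P (z 0)) \<ge> \<psi> (xh 0) + g\<psi> (xh 0) \<bullet> (?P (z 0) - xh 0) + \<sigma> / 2 * (N (?P (z 0) - xh 0))\<^sup>2"
      using assms(14) xh0 P_in unfolding strongly_convex_diff_on_def by blast
    moreover have "\<sigma> / 2 * (N (?P (z 0) - xh 0))\<^sup>2 \<ge> 0" using \<open>\<sigma> > 0\<close> by simp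
    ultimately show ?thesis
      unfolding \<Phi>_def D_def bregman_def z0 inner_diff_right by linarith
  qed
  have lip: "gf w \<bullet> (u - v) \<le> L * N (u - v)" if "w \<in> X" "u \<in> X" "v \<in> X" for w u v
    using lipschitz_gradient_bound[OF assms(3,4,5,8)] that by blast
  have step: "?A (k + 1) * (f (x (k + 1)) - f xstar) + \<Phi> (k + 1)
      \<le> ?A k * (f (x k) - f xstar) + \<Phi> k + 2 * L\<^sup>2 / \<sigma> * (a (k + 1))\<^sup>2" for k
  proof -
    let ?g = "gf (x (k + 1))" and ?a = "a (k + 1)" and ?w = "?P (zh k)" and ?p = "?P (z (k + 1))"
    have conv: "f (x (k + 1)) - f y \<le> ?g \<bullet> (x (k + 1) - y)" if "y \<in> X" for y
      using assms(6) x_in[of k] that unfolding convex_diff_on_def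
      by (fastforce simp: inner_diff_right)
    \<comment> \<open>The gradient inequality towards \<open>x k\<close> requires \<open>x k\<close>
      in \<open>X\<close>; for \<open>k = 0\<close> the factor \<open>?A 0 = 0\<close> replaces
      it.\<close>
    have "?A k * (f (x (k + 1)) - f (x k)) \<le> ?A k * (?g \<bullet> (x (k + 1) - x k))"
    proof (cases k)
      case (Suc m)
      then show ?thesis using conv[of "x k"] x_in[of m] Anonneg[of k] by (intro mult_left_mono) auto
    qed (simp add: A0)
    moreover have "?a * (f (x (k + 1)) - f xstar) \<le> ?a * (?g \<bullet> (x (k + 1) - xstar))"
      using conv[OF \<open>xstar \<in> X\<close>] apos[of "k + 1"] by (intro mult_left_mono) auto
    \<comment> \<open>Adding the two weighted gradient inequalities, this identity eliminates
      \<open>x (k + 1)\<close> and \<open>x k\<close> from the inner products and leaves only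
      \<open>?w - xstar\<close>.\<close>
    moreover have "?A (k + 1) *\<^sub>R x (k + 1) = ?A k *\<^sub>R x k + ?a *\<^sub>R ?w"
      using Apos[of k] by (subst x) (simp add: scaleR_add_right)
    then have "?g \<bullet> (?A (k + 1) *\<^sub>R x (k + 1)) = ?g \<bullet> (?A k *\<^sub>R x k + ?a *\<^sub>R ?w)" by simp
    ultimately have prim: "?A (k + 1) * (f (x (k + 1)) - f xstar) - ?A k * (f (x k) - f xstar)
        \<le> ?a * (?g \<bullet> (?w - xstar))"
      unfolding ASuc by (simp add: inner_diff_right inner_add_right algebra_simps)
    have z_inner: "z (k + 1) \<bullet> v = z k \<bullet> v - ?a * (?g \<bullet> v)" for v
      by (simp only: z inner_diff_left inner_scaleR_left)
    \<comment> \<open>The next maximizer \<open>?p\<close> is tested in the maximum at the old dual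
      point \<open>z k\<close>; replacing \<open>z k\<close> by \<open>z (k + 1)\<close> costs only
      the update term \<open>?a * (?g \<bullet> v)\<close>.\<close>
    have "z k \<bullet> ?p - \<psi> ?p + \<sigma> / 2 * (N (?p - ?P (z k)))\<^sup>2 \<le> z k \<bullet> ?P (z k) - \<psi> (?P (z k))"
      by (rule P_max[OF P_in])
    moreover have "\<sigma> / 2 * (N (?p - ?P (z k)))\<^sup>2 \<ge> 0" using \<open>\<sigma> > 0\<close> by simp
    ultimately have dual: "\<Phi> (k + 1) - \<Phi> k \<le> ?a * (?g \<bullet> (xstar - ?p))"
      using z_inner[of ?p] z_inner[of xstar]
      unfolding \<Phi>_def inner_diff_right right_diff_distrib by linarith
    have dist: "N (?w - ?p) \<le> 2 * L * ?a / \<sigma>"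
    \<comment> \<open>A positive distance can be cancelled from the quadratic inequality. The factor
      2 comes from bounding the gradients at \<open>x (k + 1)\<close> and \<open>xh k\<close>
      separately, each contributing \<open>L\<close>.\<close>
    proof (cases "N (?w - ?p) > 0")
      case True
      have "\<sigma> * (N (?w - ?p))\<^sup>2 \<le> (zh k - z (k + 1)) \<bullet> (?w - ?p)"
        using \<open>is_norm N\<close> P_in P_max by (rule argmax_monotone)
      also have "\<dots> = ?a * (?g \<bullet> (?w - ?p) + gf (xh k) \<bullet> (?p - ?w))"
        by (simp only: z zh) (simp add: inner_diff_left inner_diff_right algebra_simps)
      also have "\<dots> \<le> ?a * (L * N (?w - ?p) + L * N (?p - ?w))"
        using apos[of "k + 1"] by (intro mult_left_mono add_mono lip x_in xh_in P_in) auto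
      also have "N (?p - ?w) = N (?w - ?p)"
        using \<open>is_norm N\<close> unfolding is_norm_def
        by (metis abs_minus_cancel abs_one minus_diff_eq mult_1 scaleR_minus1_left)
      finally have "\<sigma> * N (?w - ?p) * N (?w - ?p) \<le> 2 * L * ?a * N (?w - ?p)"
        by (simp add: power2_eq_square algebra_simps)
      then have "\<sigma> * N (?w - ?p) \<le> 2 * L * ?a" using True by simp
      then show ?thesis using \<open>\<sigma> > 0\<close> by (simp add: field_simps)
    next
      case False
      moreover have "2 * L * ?a / \<sigma> \<ge> 0" using \<open>\<sigma> > 0\<close> \<open>L > 0\<close> apos[of "k + 1"] by simp
      ultimately show ?thesis by linarith
    qed
    have "?a * (?g \<bullet> (?w - ?p)) \<le> ?a * (L * N (?w - ?p))"
      using apos[of "k + 1"] by (intro mult_left_mono lip x_in P_in) auto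
    also have "\<dots> \<le> ?a * (L * (2 * L * ?a / \<sigma>))"
      using apos[of "k + 1"] \<open>L > 0\<close> dist by (intro mult_left_mono) auto
    also have "\<dots> = 2 * L\<^sup>2 / \<sigma> * ?a\<^sup>2" by (simp add: power2_eq_square)
    \<comment> \<open>In the sum of \<open>prim\<close> and \<open>dual\<close> the point
      \<open>xstar\<close> cancels, leaving exactly \<open>?g \<bullet> (?w - ?p)\<close>.\<close>
    finally show ?thesis
      using prim dual by (simp add: inner_diff_right right_diff_distrib)
  qed
  have pot: "?A k * (f (x k) - f xstar) + \<Phi> k \<le> D + 2 * L\<^sup>2 / \<sigma> * (\<Sum>i=1..k. (a i)\<^sup>2)" for k
  proof (induction k)
    case (Suc k)
    then show ?case using step[of k] by (simp add: distrib_left)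
  qed (use \<Phi>0 A0 in simp)
  have a: "a i = c * (1 / sqrt (real i))" if "i \<ge> 1" for i
    using assms(16) that by (simp add: c_def D_def real_sqrt_divide)
  have "c > 0" using apos[of 1] a[of 1] by simp
  \<comment> \<open>Positivity of the weights forces this: \<open>a 1 = c\<close>, and
    \<open>sqrt\<close> takes nonpositive values at nonpositive arguments, so
    \<open>D \<le> 0\<close> would make \<open>c \<le> 0\<close>.\<close>
  have "D > 0"
  proof (rule ccontr)
    assume "\<not> D > 0"
    then have "sqrt \<sigma> * sqrt D \<le> 0" using \<open>\<sigma> > 0\<close> by (intro mult_nonneg_nonpos) auto
    then have "c \<le> 0" unfolding c_def using \<open>L > 0\<close> by (intro divide_nonpos_pos) auto
    with \<open>c > 0\<close> show False by simp
  qed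
  \<comment> \<open>The accumulated error is thus \<open>D / 4\<close> times a harmonic sum, of the
    same scale as the initial potential.\<close>
  have c2: "2 * L\<^sup>2 / \<sigma> * c\<^sup>2 = D / 4"
    using \<open>L > 0\<close> \<open>\<sigma> > 0\<close> \<open>D > 0\<close> by (simp add: c_def power_divide power_mult_distrib)
  have bound: "f (x k) - f xstar \<le> 8 * (2 + ln (real k)) * (L * sqrt D) / (sqrt \<sigma> * sqrt (real k))"
    if "k \<ge> 1" for k
  proof -
    have ln: "ln (real k) \<ge> 0" using that by simp
    have "c * sqrt (real k) \<le> c * (\<Sum>i=1..k. 1 / sqrt (real i))"
      using \<open>c > 0\<close> by (intro mult_left_mono sqrt_le_sum_inverse_sqrt) auto
    also have "\<dots> = ?A k" unfolding weight_sum_def sum_distrib_left by (intro sum.cong) (auto simp: a)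
    \<comment> \<open>Enlarging the factor to \<open>?A k\<close> is allowed because the optimality
      gap is nonnegative; \<open>x_in\<close> is indexed by the predecessor, hence
      \<open>k - 1\<close>.\<close>
    finally have "c * sqrt (real k) * (f (x k) - f xstar) \<le> ?A k * (f (x k) - f xstar)"
      using assms(10) x_in[of "k - 1"] that by (intro mult_right_mono) auto
    also have "\<dots> \<le> D + 2 * L\<^sup>2 / \<sigma> * (\<Sum>i=1..k. (a i)\<^sup>2)"
      using pot[of k] \<Phi>_nonneg[of k] by linarith
    also have "(\<Sum>i=1..k. (a i)\<^sup>2) = c\<^sup>2 * (\<Sum>i=1..k. 1 / real i)"
      unfolding sum_distrib_left by (intro sum.cong) (auto simp: a power_mult_distrib power_divide)
    also have "D + 2 * L\<^sup>2 / \<sigma> * (c\<^sup>2 * (\<Sum>i=1..k. 1 / real i)) = D + D / 4 * (\<Sum>i=1..k. 1 / real i)"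
      by (simp flip: c2)
    also have "\<dots> \<le> D + D / 4 * (1 + ln (real k))"
      using \<open>D > 0\<close> sum_inverse_le_ln[OF that] by (intro add_left_mono mult_left_mono) auto
    \<comment> \<open>A generous estimate: together with \<open>2 * sqrt 2 \<le> 4\<close> from
      \<open>D / c\<close> below, the factor 2 makes up the constant 8.\<close>
    also have "\<dots> \<le> D * (2 * (2 + ln (real k)))"
      using \<open>D > 0\<close> ln by (simp add: field_simps)
    finally have "f (x k) - f xstar \<le> D * (2 * (2 + ln (real k))) / (c * sqrt (real k))"
      using \<open>c > 0\<close> that by (simp add: field_simps)
    also have "\<dots> = (D / c) * (2 * (2 + ln (real k))) / sqrt (real k)" by simp
    also have "D / c = 2 * sqrt 2 * (L * sqrt D / sqrt \<sigma>)"
      using \<open>D > 0\<close> \<open>\<sigma> > 0\<close> \<open>L > 0\<close> by (simp add: c_def field_simps)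
    also have "2 * sqrt 2 * (L * sqrt D / sqrt \<sigma>) * (2 * (2 + ln (real k))) / sqrt (real k)
        \<le> 4 * (L * sqrt D / sqrt \<sigma>) * (2 * (2 + ln (real k))) / sqrt (real k)"
      using \<open>D > 0\<close> \<open>\<sigma> > 0\<close> \<open>L > 0\<close> ln real_sqrt_le_mono[of 2 4]
      by (intro divide_right_mono mult_right_mono) auto
    finally show ?thesis by (simp add: mult_ac)
  qed
  show ?thesis
  proof (intro conjI impI allI)
    fix k :: nat assume k: "k \<ge> 1"
    show "f (x k) - f xstar
        \<le> 8 * (2 + ln (real k)) * (L * sqrt (bregman \<psi> g\<psi> xstar (xh 0))) / (sqrt \<sigma> * sqrt (real k))"
      using bound[OF k] by (simp only: D_def)
    assume "inner_product_norm N \<and> (\<forall>y\<in>X. \<psi> y = \<sigma> / 2 * (N y)\<^sup>2)"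
    then have "D = \<sigma> / 2 * (N (xstar - xh 0))\<^sup>2"
      unfolding D_def using assms xh0 by (intro bregman_inner_product_norm[where X = X]) auto
    moreover have "N (xstar - xh 0) \<ge> 0" using \<open>is_norm N\<close> by (simp add: is_norm_def)
    ultimately have "sqrt D = sqrt \<sigma> / sqrt 2 * N (xstar - xh 0)"
      by (simp only: real_sqrt_mult real_sqrt_divide real_sqrt_abs abs_of_nonneg)
    then have "8 * (2 + ln (real k)) * (L * sqrt D) / (sqrt \<sigma> * sqrt (real k))
        = (8 / sqrt 2) * (2 + ln (real k)) * (L * N (xstar - xh 0)) / sqrt (real k)"
      using \<open>\<sigma> > 0\<close> by simp
    also have "8 / sqrt 2 = 4 * sqrt (2::real)" by (simp add: field_simps)
    finally show "f (x k) - f xstar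
        \<le> 4 * sqrt 2 * (2 + ln (real k)) * (L * N (xstar - xh 0)) / sqrt (real k)"
      using bound[OF k] by simp
  qed
qed

end
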